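(* The relation $SC^{\mathbb{R}^1}$, restricted to regular closed subsets of $\mathbb{R}^1$, is not distributive over $\cup$ (that is, there are regular closed sets $A,B,D\subseteq\mathbb{R}^1$ with $SC^{\mathbb{R}^1}(A,B\cup D)$ but neither $SC^{\mathbb{R}^1}(A,B)$ nor $SC^{\mathbb{R}^1}(A,D)$), and thus $SC^{\mathbb{R}^1}$ is not a contact relation in the Boolean algebra $\mathcal{RC}(\mathbb{R}^1)$ of regular closed subsets of $\mathbb{R}^1$.
   Context: $\mathbb{R}^1$ is the real line with its usual topology. A set $A$ is regular closed if $A=\mathrm{Cl}(\mathrm{Int}(A))$. The regular closed sets form a Boolean algebra $\mathcal{RC}(\mathbb{R}^1)$ with complement $A^*=\mathrm{Cl}(\mathbb{R}^1\setminus A)$, join $\cup$, meet $A\sqcap B=\mathrm{Cl}(\mathrm{Int}(A\cap B))$, zero $\emptyset$ and unit $\mathbb{R}^1$. For subsets $A,B$ of $\mathbb{R}^1$, $SC^{\mathbb{R}^1}(A,B)$ holds iff there is a connected open set $E\subseteq A\cup B$ with $E\cap A\neq\emptyset$ and $E\cap B\neq\emptyset$. A contact relation in a Boolean algebra with carrier $A$, zero $0$ and join $+$ is a binary relation $C$ in $A$ such that for all $x,y,z\in A$: (C1) not $C(0,x)$; (C2) $C(x,y+z)$ iff ($C(x,y)$ or $C(x,z)$); (C3) $C(x,y)$ implies $C(y,x)$; (C4) $x\ne 0$ implies $C(x,x)$. *)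

theory Defs
  imports "HOL-Analysis.Analysis"
begin

definition regular_closed :: "'a::topological_space set \<Rightarrow> bool" where
  "regular_closed A \<longleftrightarrow> A = closure (interior A)"

typedef (overloaded) 'a rc = "{A :: 'a::topological_space set. regular_closed A}"
  morphisms set_of_rc Abs_rc
  by (rule exI[of _ "{}"]) (simp add: regular_closed_def)

setup_lifting type_definition_rc

lemma closed_regular_closed: "regular_closed A \<Longrightarrow> closed A"
  by (metis regular_closed_def closed_closure)

lemma regular_closed_closure_open:
  assumes "open U" shows "regular_closed (closure U)"
  unfolding regular_closed_def
proof
  show "closure U \<subseteq> closure (interior (closure U))"
    by (intro closure_mono interior_maximal closure_subset assms)
  show "closure (interior (closure U)) \<subseteq> closure U"
    by (intro closure_minimal interior_subset closed_closure)
qed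

lemma regular_closed_Un:
  assumes "regular_closed A" "regular_closed B"
  shows "regular_closed (A \<union> B)"
proof -
  have "A \<union> B = closure (interior A \<union> interior B)"
    using assms by (simp add: regular_closed_def)
  then show ?thesis
    by (metis regular_closed_closure_open open_Un open_interior)
qed

instantiation rc :: (topological_space) boolean_algebra
begin

lift_definition less_eq_rc :: "'a rc \<Rightarrow> 'a rc \<Rightarrow> bool" is "(\<subseteq>)" .

lift_definition less_rc :: "'a rc \<Rightarrow> 'a rc \<Rightarrow> bool" is "(\<subset>)" .

lift_definition sup_rc :: "'a rc \<Rightarrow> 'a rc \<Rightarrow> 'a rc" is "(\<union>)"
  by (rule regular_closed_Un)

lift_definition inf_rc :: "'a rc \<Rightarrow> 'a rc \<Rightarrow> 'a rc"
  is "\<lambda>A B. closure (interior (A \<inter> B))"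
  by (intro regular_closed_closure_open open_interior)

lift_definition bot_rc :: "'a rc" is "{}"
  by (simp add: regular_closed_def)

lift_definition top_rc :: "'a rc" is "UNIV"
  by (simp add: regular_closed_def)

lift_definition uminus_rc :: "'a rc \<Rightarrow> 'a rc" is "\<lambda>A. closure (UNIV - A)"
  by (intro regular_closed_closure_open open_Diff open_UNIV closed_regular_closed)

definition minus_rc :: "'a rc \<Rightarrow> 'a rc \<Rightarrow> 'a rc" where
  "minus_rc x y = inf x (- y)"

instance
proof
  fix x y z :: "'a rc"
  show "(x < y) = (x \<le> y \<and> \<not> y \<le> x)" by transfer auto
  show "x \<le> x" by transfer auto
  show "x \<le> y \<Longrightarrow> y \<le> z \<Longrightarrow> x \<le> z" by transfer auto
  show "x \<le> y \<Longrightarrow> y \<le> x \<Longrightarrow> x = y" by transfer auto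
  show "inf x y \<le> x"
    by transfer (metis Int_lower1 closure_mono interior_mono regular_closed_def)
  show "inf x y \<le> y"
    by transfer (metis Int_lower2 closure_mono interior_mono regular_closed_def)
  show "x \<le> y \<Longrightarrow> x \<le> z \<Longrightarrow> x \<le> inf y z"
    by transfer (metis Int_greatest closure_mono interior_mono regular_closed_def)
  show "x \<le> sup x y" by transfer auto
  show "y \<le> sup x y" by transfer auto
  show "y \<le> x \<Longrightarrow> z \<le> x \<Longrightarrow> sup y z \<le> x" by transfer auto
  show "bot \<le> x" by transfer auto
  show "x \<le> top" by transfer auto
  show "sup x (inf y z) = inf (sup x y) (sup x z)"
  proof (transfer, rule equalityI)
    fix A B C :: "'a set"
    assume A: "regular_closed A"
    have eq: "(A \<union> B) \<inter> (A \<union> C) = A \<union> (B \<inter> C)" by auto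
    have "A \<subseteq> closure (interior (A \<union> (B \<inter> C)))"
      using A by (metis Un_upper1 closure_mono interior_mono regular_closed_def)
    then show "A \<union> closure (interior (B \<inter> C)) \<subseteq> closure (interior ((A \<union> B) \<inter> (A \<union> C)))"
      unfolding eq by (intro Un_least closure_mono interior_mono Un_upper2)
    have clA: "closed A" using A by (rule closed_regular_closed)
    have "interior (A \<union> (B \<inter> C)) - A \<subseteq> interior (B \<inter> C)"
    proof (rule interior_maximal)
      show "interior (A \<union> (B \<inter> C)) - A \<subseteq> B \<inter> C"
        using interior_subset[of "A \<union> (B \<inter> C)"] by blast
      show "open (interior (A \<union> (B \<inter> C)) - A)"
        using clA by (simp add: open_Diff)
    qed
    then have "interior (A \<union> (B \<inter> C)) \<subseteq> A \<union> closure (interior (B \<inter> C))"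
      using closure_subset[of "interior (B \<inter> C)"] by blast
    then show "closure (interior ((A \<union> B) \<inter> (A \<union> C))) \<subseteq> A \<union> closure (interior (B \<inter> C))"
      unfolding eq by (intro closure_minimal closed_Un clA closed_closure)
  qed
  show "inf x (- x) = bot"
  proof transfer
    fix A :: "'a set"
    have "closure (UNIV - A) = - interior A"
      by (simp add: closure_complement flip: Compl_eq_Diff_UNIV)
    moreover have "interior (A \<inter> - interior A) \<subseteq> interior A"
      by (intro interior_mono) simp
    moreover have "interior (A \<inter> - interior A) \<subseteq> - interior A"
      using interior_subset[of "A \<inter> - interior A"] by blast
    ultimately have "interior (A \<inter> closure (UNIV - A)) = {}"
      by auto
    then show "closure (interior (A \<inter> closure (UNIV - A))) = {}" by simp
  qed
  show "sup x (- x) = top"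
  proof transfer
    fix A :: "'a set"
    show "A \<union> closure (UNIV - A) = UNIV"
      using closure_subset[of "UNIV - A"] by blast
  qed
  show "x - y = inf x (- y)" by (rule minus_rc_def)
qed

end

definition contact_relation :: "('a::boolean_algebra \<Rightarrow> 'a \<Rightarrow> bool) \<Rightarrow> bool" where
  "contact_relation C \<longleftrightarrow>
     (\<forall>x. \<not> C bot x) \<and>
     (\<forall>x y z. C x (sup y z) \<longleftrightarrow> C x y \<or> C x z) \<and>
     (\<forall>x y. C x y \<longrightarrow> C y x) \<and>
     (\<forall>x. x \<noteq> bot \<longrightarrow> C x x)"

definition SC :: "'a::topological_space set \<Rightarrow> 'a set \<Rightarrow> bool" where
  "SC A B \<longleftrightarrow>
     (\<exists>E. connected E \<and> open E \<and> E \<subseteq> A \<union> B \<and> E \<inter> A \<noteq> {} \<and> E \<inter> B \<noteq> {})"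

end

theory Submission
  imports Defs
begin

text \<open>
  On the real line a connected open set meeting both the half line \<open>{..0}\<close> and a set
  \<open>X \<subseteq> {0..}\<close> must contain a whole neighbourhood of \<open>0\<close>. So strong contact of \<open>{..0}\<close> with \<open>X\<close>
  fails as soon as \<open>X\<close> leaves out points arbitrarily close to \<open>0\<close> on the right
  (\<open>not_SC_half_line\<close>). It therefore suffices to split \<open>{0..}\<close> into two regular closed pieces that
  alternate infinitely often near \<open>0\<close>: each of them has gaps accumulating at \<open>0\<close>, while their union
  has none. The sign of \<open>cos (1 / x)\<close> alternates in this way (\<open>cos_inverse_oscillates\<close>); one piece
  is the closure of the set \<open>U\<close> where it is positive, the other is the relative complement
  \<open>closure ({0<..} - closure U)\<close>. The three sets refute the distributivity axiom
  of contact relations.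
\<close>

lemma not_SC_half_line:
  fixes X :: "real set"
  assumes right: "X \<subseteq> {0..}"
    and gaps: "\<And>e. e > 0 \<Longrightarrow> \<exists>x. 0 < x \<and> x < e \<and> x \<notin> X"
  shows "\<not> SC {..0} X"
proof
  assume "SC {..0} X"
  then obtain E a b where E: "connected E" "open E" "E \<subseteq> {..0} \<union> X"
    and ab: "a \<in> E" "a \<le> 0" "b \<in> E" "b \<in> X"
    unfolding SC_def by auto
  have "0 \<in> E"
    using connectedD_interval[OF E(1) ab(1,3), of 0] ab(2,4) right by auto
  then obtain e where e: "e > 0" "ball 0 e \<subseteq> E"
    using E(2) open_contains_ball by blast
  obtain x where x: "0 < x" "x < e" "x \<notin> X"
    using gaps[OF e(1)] by blast
  then have "x \<in> ball 0 e" by (simp add: dist_real_def)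
  then have "x \<in> {..0} \<union> X" using e(2) E(3) by blast
  then show False using x by simp
qed

lemma cos_inverse_oscillates:
  fixes e :: real
  assumes "e > 0"
  shows "\<exists>x. 0 < x \<and> x < e \<and> cos (1 / x) = (-1) ^ k"
proof -
  obtain n :: nat where n: "1 / e < real n"
    using reals_Archimedean2 by blast
  define t where "t = real (2 * n + k) * pi"
  have "real n * 1 \<le> real (2 * n + k) * pi"
    using pi_gt3 by (intro mult_mono) auto
  then have t: "1 / e < t" using n by (simp add: t_def)
  moreover have "0 < 1 / e" using assms by simp
  ultimately have "t > 0" by linarith
  then have "1 / t < e" using t assms by (simp add: field_simps)
  moreover have "cos t = (-1) ^ k"
    unfolding t_def cos_npi by (simp add: power_add)
  ultimately show ?thesis
    using \<open>t > 0\<close> by (intro exI[of _ "1 / t"]) auto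
qed

lemma open_cos_inverse_pos: "open {x :: real. 0 < x \<and> 0 < c * cos (1 / x)}"
proof -
  have "continuous_on {0<..} (\<lambda>x :: real. c * cos (1 / x))"
    by (intro continuous_intros) auto
  then have "open ((\<lambda>x. c * cos (1 / x)) -` {0<..} \<inter> {0 :: real<..})"
    by (simp add: continuous_on_open_vimage)
  moreover have "(\<lambda>x. c * cos (1 / x)) -` {0<..} \<inter> {0 :: real<..}
      = {x. 0 < x \<and> 0 < c * cos (1 / x)}" by auto
  ultimately show ?thesis by simp
qed

lemma SC_Un_not_distributive:
  "\<exists>A B D :: real set. regular_closed A \<and> regular_closed B \<and> regular_closed D \<and>
     SC A (B \<union> D) \<and> \<not> SC A B \<and> \<not> SC A D"
proof -
  define U where "U = {x :: real. 0 < x \<and> 0 < cos (1 / x)}"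
  define V where "V = {x :: real. 0 < x \<and> cos (1 / x) < 0}"
  define B where "B = closure U"
  define D where "D = closure ({0<..} - B)"
  have oU: "open U" and oV: "open V"
    using open_cos_inverse_pos[of 1] open_cos_inverse_pos[of "-1"] by (simp_all add: U_def V_def)
  have oD: "open ({0<..} - B)"
    unfolding B_def by (intro open_Diff closed_closure) auto

  have "U \<inter> V = {}" by (auto simp: U_def V_def)
  then have BV: "V \<inter> B = {}"
    unfolding B_def using open_Int_closure_eq_empty[OF oV] by blast
  have "U \<inter> ({0<..} - B) = {}"
    unfolding B_def using closure_subset by blast
  then have DU: "U \<inter> D = {}"
    unfolding D_def using open_Int_closure_eq_empty[OF oU] by blast

  have B0: "B \<subseteq> {0..}"
    unfolding B_def by (intro closure_minimal) (auto simp: U_def)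
  have D0: "D \<subseteq> {0..}"
    unfolding D_def by (intro closure_minimal) auto

  have rA: "regular_closed {..0 :: real}"
    using regular_closed_closure_open[of "{..<0 :: real}"] by simp
  have rB: "regular_closed B" and rD: "regular_closed D"
    using oU oD by (simp_all add: B_def D_def regular_closed_closure_open)

  have cover: "{0<..} \<subseteq> B \<union> D"
    unfolding D_def using closure_subset[of "{0<..} - B"] by blast
  have "x \<in> {..0} \<union> (B \<union> D)" for x
    using subsetD[OF cover, of x] by (cases "x \<le> 0") simp_all
  then have "UNIV \<subseteq> {..0} \<union> (B \<union> D)" by blast
  moreover have "1 \<in> B \<union> D"
    using subsetD[OF cover, of 1] by simp
  moreover have "(0 :: real) \<in> {..0}" by simp
  ultimately have "SC {..0} (B \<union> D)"
    unfolding SC_def by (intro exI[of _ UNIV] conjI connected_UNIV open_UNIV) blast+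

  moreover have "\<not> SC {..0} B"
  proof (rule not_SC_half_line[OF B0])
    fix e :: real assume "e > 0"
    from cos_inverse_oscillates[OF this, of 1]
    obtain x where x: "0 < x" "x < e" "cos (1 / x) = -1" by auto
    then have "x \<in> V" by (simp add: V_def)
    then show "\<exists>x. 0 < x \<and> x < e \<and> x \<notin> B" using x BV by blast
  qed

  moreover have "\<not> SC {..0} D"
  proof (rule not_SC_half_line[OF D0])
    fix e :: real assume "e > 0"
    from cos_inverse_oscillates[OF this, of 0]
    obtain x where x: "0 < x" "x < e" "cos (1 / x) = 1" by auto
    then have "x \<in> U" by (simp add: U_def)
    then show "\<exists>x. 0 < x \<and> x < e \<and> x \<notin> D" using x DU by blast
  qed

  ultimately show ?thesis using rA rB rD by blast
qed

theorem mainTheorem2: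
  shows "(\<exists>A B D :: real set. regular_closed A \<and> regular_closed B \<and> regular_closed D \<and>
            SC A (B \<union> D) \<and> \<not> SC A B \<and> \<not> SC A D) \<and>
         \<not> contact_relation (\<lambda>X Y :: real rc. SC (set_of_rc X) (set_of_rc Y))"
proof
  show "\<exists>A B D :: real set. regular_closed A \<and> regular_closed B \<and> regular_closed D \<and>
            SC A (B \<union> D) \<and> \<not> SC A B \<and> \<not> SC A D"
    by (rule SC_Un_not_distributive)
  then obtain A B D :: "real set"
    where reg: "regular_closed A" "regular_closed B" "regular_closed D"
      and SC: "SC A (B \<union> D)" "\<not> SC A B" "\<not> SC A D" by blast
  let ?C = "\<lambda>X Y :: real rc. SC (set_of_rc X) (set_of_rc Y)"
  have "?C (Abs_rc A) (sup (Abs_rc B) (Abs_rc D))"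
    "\<not> ?C (Abs_rc A) (Abs_rc B)" "\<not> ?C (Abs_rc A) (Abs_rc D)"
    using reg SC by (simp_all add: Abs_rc_inverse sup_rc.rep_eq)
  then show "\<not> contact_relation ?C"
    unfolding contact_relation_def by blast
qed

end
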